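(* Let $Q$ be a Buchsteiner loop of nilpotency class two. Then $Q$ is conjugacy closed.
   Context: A Buchsteiner loop is a loop $Q$ satisfying $x\backslash (xy\cdot z) = (y\cdot zx)/x$ for all $x,y,z$, where $\backslash$ and $/$ are left and right division. The centre $Z(Q)$ of a loop consists of the elements of the nucleus that commute with all elements of $Q$ (the nucleus being the set of all $a$ with $a(xy)=(ax)y$, $x(ay)=(xa)y$, $x(ya)=(xy)a$ for all $x,y$). The upper central series and nilpotency class are defined from $Z(Q)$ as for groups. A loop is conjugacy closed if for all $x,y$ the conjugate $L_xL_yL_x^{-1}$ is a left translation and $R_xR_yR_x^{-1}$ is a right translation, where $L_x(y)=xy$, $R_x(y)=yx$. *)

theory Defs
  imports "HOL-Algebra.Coset" "HOL-Algebra.Bij"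
begin

locale loop =
  fixes Q (structure)
  assumes m_closed: "\<lbrakk>x \<in> carrier Q; y \<in> carrier Q\<rbrakk> \<Longrightarrow> x \<otimes> y \<in> carrier Q"
    and one_closed: "\<one> \<in> carrier Q"
    and l_one: "x \<in> carrier Q \<Longrightarrow> \<one> \<otimes> x = x"
    and r_one: "x \<in> carrier Q \<Longrightarrow> x \<otimes> \<one> = x"
    and l_division: "\<lbrakk>x \<in> carrier Q; z \<in> carrier Q\<rbrakk> \<Longrightarrow> \<exists>!y. y \<in> carrier Q \<and> x \<otimes> y = z"
    and r_division: "\<lbrakk>x \<in> carrier Q; z \<in> carrier Q\<rbrakk> \<Longrightarrow> \<exists>!y. y \<in> carrier Q \<and> y \<otimes> x = z"

(* ldiv Q x z is x\z, and rdiv Q z x is z/x. *)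

definition ldiv :: "('a, 'b) monoid_scheme \<Rightarrow> 'a \<Rightarrow> 'a \<Rightarrow> 'a" where
  "ldiv Q x z = (THE y. y \<in> carrier Q \<and> x \<otimes>\<^bsub>Q\<^esub> y = z)"

definition rdiv :: "('a, 'b) monoid_scheme \<Rightarrow> 'a \<Rightarrow> 'a \<Rightarrow> 'a" where
  "rdiv Q z x = (THE y. y \<in> carrier Q \<and> y \<otimes>\<^bsub>Q\<^esub> x = z)"

locale buchsteiner_loop = loop +
  assumes buchsteiner: "\<lbrakk>x \<in> carrier Q; y \<in> carrier Q; z \<in> carrier Q\<rbrakk> \<Longrightarrow>
    ldiv Q x ((x \<otimes> y) \<otimes> z) = rdiv Q (y \<otimes> (z \<otimes> x)) x"

definition nucleus :: "('a, 'b) monoid_scheme \<Rightarrow> 'a set" where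
  "nucleus Q = {a \<in> carrier Q. \<forall>x\<in>carrier Q. \<forall>y\<in>carrier Q.
     a \<otimes>\<^bsub>Q\<^esub> (x \<otimes>\<^bsub>Q\<^esub> y) = (a \<otimes>\<^bsub>Q\<^esub> x) \<otimes>\<^bsub>Q\<^esub> y \<and>
     x \<otimes>\<^bsub>Q\<^esub> (a \<otimes>\<^bsub>Q\<^esub> y) = (x \<otimes>\<^bsub>Q\<^esub> a) \<otimes>\<^bsub>Q\<^esub> y \<and>
     x \<otimes>\<^bsub>Q\<^esub> (y \<otimes>\<^bsub>Q\<^esub> a) = (x \<otimes>\<^bsub>Q\<^esub> y) \<otimes>\<^bsub>Q\<^esub> a}"

definition centre :: "('a, 'b) monoid_scheme \<Rightarrow> 'a set" where
  "centre Q = {a \<in> nucleus Q. \<forall>x\<in>carrier Q. a \<otimes>\<^bsub>Q\<^esub> x = x \<otimes>\<^bsub>Q\<^esub> a}"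

(* The quotient Q Mod N has the cosets of N as its elements and multiplies them as subsets
   of Q; for a normal subloop N this is the usual quotient loop, (N a)(N b) = N (a b).
   The recursion says that Z (n + 1) is the preimage of the centre of Q / Z n. *)

fun upper_central :: "('a, 'b) monoid_scheme \<Rightarrow> nat \<Rightarrow> 'a set" where
  "upper_central Q 0 = {\<one>\<^bsub>Q\<^esub>}"
| "upper_central Q (Suc n) =
    {x \<in> carrier Q. upper_central Q n #>\<^bsub>Q\<^esub> x \<in> centre (Q Mod upper_central Q n)}"

(* The class is exactly c: smaller indices do not reach Q. *)

definition has_nilpotency_class :: "('a, 'b) monoid_scheme \<Rightarrow> nat \<Rightarrow> bool" where
  "has_nilpotency_class Q c \<longleftrightarrow>
     upper_central Q c = carrier Q \<and> (\<forall>n<c. upper_central Q n \<noteq> carrier Q)"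

(* In a loop the translations are elements of the symmetric group BijGroup (carrier Q),
   whose elements are extensional maps; hence the restriction to the carrier. *)

definition ltrans :: "('a, 'b) monoid_scheme \<Rightarrow> 'a \<Rightarrow> 'a \<Rightarrow> 'a" where
  "ltrans Q x = (\<lambda>y\<in>carrier Q. x \<otimes>\<^bsub>Q\<^esub> y)"

definition rtrans :: "('a, 'b) monoid_scheme \<Rightarrow> 'a \<Rightarrow> 'a \<Rightarrow> 'a" where
  "rtrans Q x = (\<lambda>y\<in>carrier Q. y \<otimes>\<^bsub>Q\<^esub> x)"

definition conjugacy_closed :: "('a, 'b) monoid_scheme \<Rightarrow> bool" where
  "conjugacy_closed Q \<longleftrightarrow> (let S = BijGroup (carrier Q) in
     \<forall>x\<in>carrier Q. \<forall>y\<in>carrier Q.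
       ltrans Q x \<otimes>\<^bsub>S\<^esub> ltrans Q y \<otimes>\<^bsub>S\<^esub> inv\<^bsub>S\<^esub> (ltrans Q x) \<in> ltrans Q ` carrier Q \<and>
       rtrans Q x \<otimes>\<^bsub>S\<^esub> rtrans Q y \<otimes>\<^bsub>S\<^esub> inv\<^bsub>S\<^esub> (rtrans Q x) \<in> rtrans Q ` carrier Q)"

lemma (in loop) ltrans_Bij:
  assumes "x \<in> carrier Q"
  shows "ltrans Q x \<in> carrier (BijGroup (carrier Q))"
proof -
  have "inj_on (ltrans Q x) (carrier Q)"
  proof (rule inj_onI)
    fix y z assume yz: "y \<in> carrier Q" "z \<in> carrier Q" "ltrans Q x y = ltrans Q x z"
    then have "x \<otimes> y = x \<otimes> z" by (simp add: ltrans_def)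
    then show "y = z"
      using l_division[OF assms m_closed[OF assms yz(1)]] yz(1,2) by auto
  qed
  moreover have "ltrans Q x ` carrier Q = carrier Q"
  proof (intro equalityI subsetI)
    fix z assume "z \<in> ltrans Q x ` carrier Q"
    then show "z \<in> carrier Q" using assms by (auto simp: ltrans_def intro: m_closed)
  next
    fix z assume "z \<in> carrier Q"
    then obtain y where "y \<in> carrier Q" "x \<otimes> y = z" using l_division[OF assms] by blast
    then show "z \<in> ltrans Q x ` carrier Q" by (force simp: ltrans_def)
  qed
  ultimately have "bij_betw (ltrans Q x) (carrier Q) (carrier Q)"
    by (simp add: bij_betw_def)
  then show ?thesis by (simp add: BijGroup_def Bij_def ltrans_def)
qed

lemma (in loop) rtrans_Bij:
  assumes "x \<in> carrier Q"
  shows "rtrans Q x \<in> carrier (BijGroup (carrier Q))"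
proof -
  have "inj_on (rtrans Q x) (carrier Q)"
  proof (rule inj_onI)
    fix y z assume yz: "y \<in> carrier Q" "z \<in> carrier Q" "rtrans Q x y = rtrans Q x z"
    then have "y \<otimes> x = z \<otimes> x" by (simp add: rtrans_def)
    then show "y = z"
      using r_division[OF assms m_closed[OF yz(1) assms]] yz(1,2) by auto
  qed
  moreover have "rtrans Q x ` carrier Q = carrier Q"
  proof (intro equalityI subsetI)
    fix z assume "z \<in> rtrans Q x ` carrier Q"
    then show "z \<in> carrier Q" using assms by (auto simp: rtrans_def intro: m_closed)
  next
    fix z assume "z \<in> carrier Q"
    then obtain y where "y \<in> carrier Q" "y \<otimes> x = z" using r_division[OF assms] by blast
    then show "z \<in> rtrans Q x ` carrier Q" by (force simp: rtrans_def)
  qed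
  ultimately have "bij_betw (rtrans Q x) (carrier Q) (carrier Q)"
    by (simp add: bij_betw_def)
  then show ?thesis by (simp add: BijGroup_def Bij_def rtrans_def)
qed

lemma (in loop) upper_central_1: "upper_central Q 1 = centre Q"
proof -
  have c: "{\<one>} #> x = {x}" if "x \<in> carrier Q" for x
    using that by (simp add: r_coset_def l_one)
  have cr: "carrier (Q Mod {\<one>}) = (\<lambda>x. {x}) ` carrier Q"
    using c by (auto simp: FactGroup_def RCOSETS_def)
  have m: "{x} \<otimes>\<^bsub>Q Mod {\<one>}\<^esub> {y} = {x \<otimes> y}" for x y
    by (simp add: FactGroup_def set_mult_def)
  have "upper_central Q 1 = {x \<in> carrier Q. {x} \<in> centre (Q Mod {\<one>})}"
    using c by (simp cong: conj_cong)
  also have "\<dots> = centre Q"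
    unfolding centre_def nucleus_def mem_Collect_eq cr ball_simps m inj_image_mem_iff[OF inj_singleton]
    by blast
  finally show ?thesis .
qed

end

theory Submission
  imports Defs
begin

text \<open>
  The quotient of \<open>Q\<close> by its centre \<open>Z\<close> is an abelian group, so commutators \<open>c(x,y)\<close> and
  associators \<open>a(x,y,z)\<close>, given by \<open>xy = c(x,y) \<cdot> yx\<close> and \<open>xy\<cdot>z = a(x,y,z) \<cdot> (x\<cdot>yz)\<close>, lie in \<open>Z\<close>.
  In these terms:

  \<^item> The Buchsteiner law says \<open>a(x,y,z) a(y,z,x) = 1\<close>. Going once around the cycle
    \<open>(x,y,z) \<rightarrow> (y,z,x) \<rightarrow> (z,x,y)\<close> inverts three times, so \<open>a\<close> takes values of order at most two and
    is invariant under cyclic shifts.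
  \<^item> Moving \<open>z\<close> past \<open>xy\<close> either at once or one factor at a time gives the hexagon identity
    \<open>c(xy,z) = a(x,y,z) c(y,z) a(x,z,y)\<inverse> c(x,z) a(z,x,y)\<close>. By the previous item this reduces to
    \<open>c(xy,z) = a(x,z,y) c(y,z) c(x,z)\<close>. Since \<open>xy\<close> and \<open>yx\<close> differ by a central factor, the left hand
    side is symmetric in \<open>x\<close> and \<open>y\<close>, and hence so is \<open>a(x,z,y)\<close>. Together with the cyclic
    invariance, \<open>a\<close> is invariant under all permutations of its arguments.
  \<^item> The loop is conjugacy closed as soon as \<open>a\<close> is unchanged by swapping its first two
    and by swapping its last two arguments: \<open>L\<^sub>x\<close> conjugates \<open>L\<^sub>y\<close> to the left translation by
    \<open>c(x,y) y\<close>, and \<open>R\<^sub>x\<close> conjugates \<open>R\<^sub>y\<close> to the right translation by \<open>c(y,x) y\<close>.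
\<close>

section \<open>Loops and their centre\<close>

context loop
begin

lemma l_cancel:
  assumes "x \<in> carrier Q" "y \<in> carrier Q" "z \<in> carrier Q" "x \<otimes> y = x \<otimes> z"
  shows "y = z"
  using l_division[OF assms(1) m_closed[OF assms(1,2)]] assms by metis

lemma r_cancel:
  assumes "x \<in> carrier Q" "y \<in> carrier Q" "z \<in> carrier Q" "y \<otimes> x = z \<otimes> x"
  shows "y = z"
  using r_division[OF assms(1) m_closed[OF assms(2,1)]] assms by metis

lemma ldiv_props:
  assumes "x \<in> carrier Q" "z \<in> carrier Q"
  shows "ldiv Q x z \<in> carrier Q" "x \<otimes> ldiv Q x z = z"
  using theI'[OF l_division[OF assms]] by (simp_all add: ldiv_def)

lemma rdiv_props:
  assumes "x \<in> carrier Q" "z \<in> carrier Q"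
  shows "rdiv Q z x \<in> carrier Q" "rdiv Q z x \<otimes> x = z"
  using theI'[OF r_division[OF assms]] by (simp_all add: rdiv_def)

lemma rdiv_eqI:
  assumes "x \<in> carrier Q" "y \<in> carrier Q" "y \<otimes> x = z"
  shows "rdiv Q z x = y"
  using rdiv_props[of x z] r_cancel[of x _ y] assms m_closed by metis

lemma centre_closed: "a \<in> centre Q \<Longrightarrow> a \<in> carrier Q"
  by (simp add: centre_def nucleus_def)

lemma one_centre: "\<one> \<in> centre Q"
  by (simp add: centre_def nucleus_def one_closed l_one r_one m_closed)

text \<open>
  The next rules describe how central elements act by multiplication. As rewrite rules they pull
  central factors to the front of a product and sort them there; \<open>centre_pull_right\<close>, whose sides
  differ only by a permutation of variables, has to be instantiated to be directed.
\<close>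

lemma centre_pull_left:
  assumes "a \<in> centre Q" "x \<in> carrier Q" "y \<in> carrier Q"
  shows "(a \<otimes> x) \<otimes> y = a \<otimes> (x \<otimes> y)"
  using assms by (simp add: centre_def nucleus_def)

lemma centre_pull_right:
  assumes "a \<in> centre Q" "x \<in> carrier Q" "y \<in> carrier Q"
  shows "x \<otimes> (a \<otimes> y) = a \<otimes> (x \<otimes> y)"
proof -
  have "x \<otimes> (a \<otimes> y) = (x \<otimes> a) \<otimes> y"
    using assms unfolding centre_def nucleus_def by blast
  moreover have "x \<otimes> a = a \<otimes> x"
    using assms by (simp add: centre_def)
  ultimately show ?thesis
    using assms by (simp add: centre_pull_left)
qed

lemma centre_commute:
  assumes "a \<in> centre Q" "x \<in> carrier Q"
  shows "a \<otimes> x = x \<otimes> a"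
  using assms by (simp add: centre_def)

lemma centre_left_commute:
  assumes "a \<in> centre Q" "b \<in> centre Q" "x \<in> carrier Q"
  shows "a \<otimes> (b \<otimes> x) = b \<otimes> (a \<otimes> x)"
  using assms centre_pull_right centre_closed by blast

lemmas centre_pull = centre_pull_left centre_left_commute

lemma centreI:
  assumes "a \<in> carrier Q"
    and "\<And>x. x \<in> carrier Q \<Longrightarrow> x \<otimes> a = a \<otimes> x"
    and "\<And>x y. \<lbrakk>x \<in> carrier Q; y \<in> carrier Q\<rbrakk> \<Longrightarrow> (a \<otimes> x) \<otimes> y = a \<otimes> (x \<otimes> y)"
    and "\<And>x y. \<lbrakk>x \<in> carrier Q; y \<in> carrier Q\<rbrakk> \<Longrightarrow> x \<otimes> (a \<otimes> y) = a \<otimes> (x \<otimes> y)"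
  shows "a \<in> centre Q"
  using assms by (simp add: centre_def nucleus_def m_closed)

lemma centre_mult:
  assumes a: "a \<in> centre Q" and b: "b \<in> centre Q"
  shows "a \<otimes> b \<in> centre Q"
proof (rule centreI)
  have ab: "a \<in> carrier Q" "b \<in> carrier Q"
    using a b by (auto intro: centre_closed)
  then show "a \<otimes> b \<in> carrier Q"
    by (rule m_closed)
  have act: "(a \<otimes> b) \<otimes> x = a \<otimes> (b \<otimes> x)" if "x \<in> carrier Q" for x
    using that a ab by (simp add: centre_pull_left)
  show "x \<otimes> (a \<otimes> b) = (a \<otimes> b) \<otimes> x" if "x \<in> carrier Q" for x
    using that a b ab act centre_pull_right[of a x b] centre_commute[of b x] by simp
  show "((a \<otimes> b) \<otimes> x) \<otimes> y = (a \<otimes> b) \<otimes> (x \<otimes> y)"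
    if "x \<in> carrier Q" "y \<in> carrier Q" for x y
    using that a b ab act by (simp add: centre_pull_left m_closed)
  show "x \<otimes> ((a \<otimes> b) \<otimes> y) = (a \<otimes> b) \<otimes> (x \<otimes> y)"
    if "x \<in> carrier Q" "y \<in> carrier Q" for x y
    using that a b ab act centre_pull_right[of a x "b \<otimes> y"] centre_pull_right[of b x y]
    by (simp add: m_closed)
qed

section \<open>Commutators and associators modulo the centre\<close>

definition commutator :: "'a \<Rightarrow> 'a \<Rightarrow> 'a" where
  "commutator x y = rdiv Q (x \<otimes> y) (y \<otimes> x)"

definition associator :: "'a \<Rightarrow> 'a \<Rightarrow> 'a \<Rightarrow> 'a" where
  "associator x y z = rdiv Q ((x \<otimes> y) \<otimes> z) (x \<otimes> (y \<otimes> z))"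

lemma mem_coset_centre:
  assumes "x \<in> carrier Q"
  shows "x \<in> centre Q #> x"
  using assms one_centre l_one by (force simp: r_coset_def)

text \<open>
  The product of two cosets of the centre, formed as a product of sets, is again the coset
  of the product, which is what makes computations in the quotient meaningful.
\<close>

lemma mult_coset_centre:
  assumes x: "x \<in> carrier Q" and y: "y \<in> carrier Q"
  shows "(centre Q #> x) <#> (centre Q #> y) = centre Q #> (x \<otimes> y)"
proof (intro equalityI subsetI)
  fix u assume "u \<in> (centre Q #> x) <#> (centre Q #> y)"
  then obtain a b where ab: "a \<in> centre Q" "b \<in> centre Q" "u = (a \<otimes> x) \<otimes> (b \<otimes> y)"
    by (auto simp: set_mult_def r_coset_def)
  then have "u = (a \<otimes> b) \<otimes> (x \<otimes> y)"
    using x y by (simp add: centre_pull_left centre_pull_right[of b x y] centre_closed m_closed)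
  then show "u \<in> centre Q #> (x \<otimes> y)"
    using centre_mult[OF ab(1,2)] by (auto simp: r_coset_def)
next
  fix u assume "u \<in> centre Q #> (x \<otimes> y)"
  then obtain a where a: "a \<in> centre Q" "u = (a \<otimes> x) \<otimes> y"
    using x y by (auto simp: r_coset_def centre_pull_left)
  then have "a \<otimes> x \<in> centre Q #> x"
    by (auto simp: r_coset_def)
  then show "u \<in> (centre Q #> x) <#> (centre Q #> y)"
    using mem_coset_centre[OF y] a(2) by (auto simp: set_mult_def)
qed

end

text \<open>Loops that are an abelian group modulo their centre.\<close>

locale class_two_loop = loop +
  assumes commutator_centre:
      "\<lbrakk>x \<in> carrier Q; y \<in> carrier Q\<rbrakk> \<Longrightarrow> commutator x y \<in> centre Q"
    and associator_centre:
      "\<lbrakk>x \<in> carrier Q; y \<in> carrier Q; z \<in> carrier Q\<rbrakk> \<Longrightarrow> associator x y z \<in> centre Q"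

lemma (in loop) class_two_loopI:
  assumes "has_nilpotency_class Q 2"
  shows "class_two_loop Q"
proof -
  let ?Z = "centre Q"
  let ?C = "\<lambda>x. centre Q #> x"
  have "upper_central Q (Suc 1) = carrier Q"
    using assms by (simp only: has_nilpotency_class_def numeral_2_eq_2 One_nat_def)
  then have "carrier Q = {x \<in> carrier Q. ?C x \<in> centre (Q Mod ?Z)}"
    by (simp only: upper_central.simps(2) upper_central_1)
  then have centre: "?C x \<in> centre (Q Mod ?Z)" if "x \<in> carrier Q" for x
    using that by blast
  have coset: "?C x \<in> carrier (Q Mod ?Z)" if "x \<in> carrier Q" for x
    using centre[OF that] by (simp add: centre_def nucleus_def)
  have mult: "?C x \<otimes>\<^bsub>Q Mod ?Z\<^esub> ?C y = ?C (x \<otimes> y)"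
    if "x \<in> carrier Q" "y \<in> carrier Q" for x y
    using mult_coset_centre[OF that] by (simp add: FactGroup_def)
  have central: "rdiv Q u v \<in> ?Z"
    if uv: "?C u = ?C v" "u \<in> carrier Q" "v \<in> carrier Q" for u v
  proof -
    obtain a where "a \<in> ?Z" "u = a \<otimes> v"
      using mem_coset_centre[OF uv(2)] unfolding uv(1) by (auto simp: r_coset_def)
    then show ?thesis
      using uv(3) rdiv_eqI[of v a u] centre_closed by simp
  qed
  have "commutator x y \<in> ?Z" if "x \<in> carrier Q" "y \<in> carrier Q" for x y
  proof -
    have "?C x \<otimes>\<^bsub>Q Mod ?Z\<^esub> ?C y = ?C y \<otimes>\<^bsub>Q Mod ?Z\<^esub> ?C x"
      using centre[OF that(1)] coset[OF that(2)] by (simp add: centre_def)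
    then show ?thesis
      unfolding commutator_def using that by (intro central) (simp_all only: mult m_closed)
  qed
  moreover have "associator x y z \<in> ?Z"
    if "x \<in> carrier Q" "y \<in> carrier Q" "z \<in> carrier Q" for x y z
  proof -
    have "?C x \<otimes>\<^bsub>Q Mod ?Z\<^esub> (?C y \<otimes>\<^bsub>Q Mod ?Z\<^esub> ?C z) =
        (?C x \<otimes>\<^bsub>Q Mod ?Z\<^esub> ?C y) \<otimes>\<^bsub>Q Mod ?Z\<^esub> ?C z"
      using centre[OF that(1)] coset[OF that(2)] coset[OF that(3)]
      unfolding centre_def nucleus_def by blast
    then show ?thesis
      unfolding associator_def using that by (intro central) (simp_all only: mult m_closed)
  qed
  ultimately show ?thesis
    by unfold_locales
qed

context class_two_loop
begin

lemma swap:
  assumes "x \<in> carrier Q" "y \<in> carrier Q"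
  shows "x \<otimes> y = commutator x y \<otimes> (y \<otimes> x)"
  using assms by (simp add: commutator_def rdiv_props m_closed)

lemma reassociate:
  assumes "x \<in> carrier Q" "y \<in> carrier Q" "z \<in> carrier Q"
  shows "(x \<otimes> y) \<otimes> z = associator x y z \<otimes> (x \<otimes> (y \<otimes> z))"
  using assms by (simp add: associator_def rdiv_props m_closed)

lemmas closed = m_closed centre_closed commutator_centre associator_centre

lemma commutator_centre_mult:
  assumes "a \<in> centre Q" "x \<in> carrier Q" "z \<in> carrier Q"
  shows "commutator (a \<otimes> x) z = commutator x z"
  unfolding commutator_def[of "a \<otimes> x"]
proof (rule rdiv_eqI)
  show "commutator x z \<otimes> (z \<otimes> (a \<otimes> x)) = (a \<otimes> x) \<otimes> z"
    using assms swap[of x z] by (simp add: closed centre_pull centre_pull_right[of a z x])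
qed (use assms in \<open>simp_all add: closed\<close>)

section \<open>Conjugacy closedness from symmetric associators\<close>

text \<open>
  The definition of conjugacy closedness uses inverses in the symmetric group;
  \<open>f \<circ> g = h \<circ> f\<close> is the form of \<open>f \<circ> g \<circ> f\<inverse> = h\<close> that can be checked pointwise.
\<close>

lemma conj_BijI:
  assumes "f \<in> carrier (BijGroup S)" "g \<in> carrier (BijGroup S)" "h \<in> carrier (BijGroup S)"
    and "\<And>z. z \<in> S \<Longrightarrow> f (g z) = h (f z)"
  shows "f \<otimes>\<^bsub>BijGroup S\<^esub> g \<otimes>\<^bsub>BijGroup S\<^esub> inv\<^bsub>BijGroup S\<^esub> f = h"
proof -
  interpret G: group "BijGroup S" by (rule group_BijGroup)
  have "f \<otimes>\<^bsub>BijGroup S\<^esub> g = h \<otimes>\<^bsub>BijGroup S\<^esub> f"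
    using assms by (auto simp: BijGroup_def compose_def restrict_def)
  then show ?thesis
    using assms(1,2,3) by (simp add: G.m_assoc)
qed

text \<open>
  Rewriting \<open>x\<cdot>yz\<close> as \<open>c(x,y) y \<cdot> xz\<close> takes two reassociations with a commutation of \<open>x\<close> and \<open>y\<close> in
  between, so its defect is \<open>a(x,y,z)\<close> times the inverse of \<open>a(y,x,z)\<close>, which the symmetry of
  associators makes trivial; dually for right translations.
\<close>

lemma conjugacy_closedI:
  assumes swap_left: "\<And>x y z. \<lbrakk>x \<in> carrier Q; y \<in> carrier Q; z \<in> carrier Q\<rbrakk> \<Longrightarrow>
      associator x y z = associator y x z"
    and swap_right: "\<And>x y z. \<lbrakk>x \<in> carrier Q; y \<in> carrier Q; z \<in> carrier Q\<rbrakk> \<Longrightarrow>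
      associator x y z = associator x z y"
  shows "conjugacy_closed Q"
proof -
  let ?S = "BijGroup (carrier Q)"
  have "ltrans Q x \<otimes>\<^bsub>?S\<^esub> ltrans Q y \<otimes>\<^bsub>?S\<^esub> inv\<^bsub>?S\<^esub> (ltrans Q x) = ltrans Q (commutator x y \<otimes> y)"
    if x: "x \<in> carrier Q" and y: "y \<in> carrier Q" for x y
  proof (rule conj_BijI)
    fix z assume z: "z \<in> carrier Q"
    let ?a = "associator x y z" and ?c = "commutator x y"
    have "?a \<otimes> (x \<otimes> (y \<otimes> z)) = (x \<otimes> y) \<otimes> z"
      using x y z by (simp add: reassociate)
    also have "\<dots> = ?c \<otimes> ((y \<otimes> x) \<otimes> z)"
      using x y z by (simp add: swap[of x y] closed centre_pull)
    also have "\<dots> = ?a \<otimes> ((?c \<otimes> y) \<otimes> (x \<otimes> z))"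
      using x y z by (simp add: reassociate[of y x z] swap_left[of y x] closed centre_pull)
    finally have "x \<otimes> (y \<otimes> z) = (?c \<otimes> y) \<otimes> (x \<otimes> z)"
      by (rule l_cancel[rotated 3]) (use x y z in \<open>simp_all add: closed\<close>)
    then show "ltrans Q x (ltrans Q y z) = ltrans Q (?c \<otimes> y) (ltrans Q x z)"
      using x y z by (simp add: ltrans_def closed)
  qed (use x y in \<open>simp_all add: ltrans_Bij closed\<close>)
  moreover
  have "rtrans Q x \<otimes>\<^bsub>?S\<^esub> rtrans Q y \<otimes>\<^bsub>?S\<^esub> inv\<^bsub>?S\<^esub> (rtrans Q x) = rtrans Q (commutator y x \<otimes> y)"
    if x: "x \<in> carrier Q" and y: "y \<in> carrier Q" for x y
  proof (rule conj_BijI)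
    fix z assume z: "z \<in> carrier Q"
    let ?a = "associator z x y" and ?c = "commutator y x"
    have "(z \<otimes> y) \<otimes> x = ?a \<otimes> (z \<otimes> (y \<otimes> x))"
      using x y z by (simp add: reassociate[of z y x] swap_right[of z y])
    also have "\<dots> = ?c \<otimes> (?a \<otimes> (z \<otimes> (x \<otimes> y)))"
      using x y z by (simp add: swap[of y x] closed centre_pull centre_pull_right[of ?c z])
    also have "\<dots> = (z \<otimes> x) \<otimes> (?c \<otimes> y)"
      using x y z centre_pull_right[of ?c "z \<otimes> x" y] by (simp add: reassociate[of z x y] closed)
    finally show "rtrans Q x (rtrans Q y z) = rtrans Q (?c \<otimes> y) (rtrans Q x z)"
      using x y z by (simp add: rtrans_def closed)
  qed (use x y in \<open>simp_all add: rtrans_Bij closed\<close>)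
  ultimately show ?thesis
    by (simp add: conjugacy_closed_def Let_def closed)
qed

end

section \<open>Associators in Buchsteiner loops of class two\<close>

locale class_two_buchsteiner_loop = class_two_loop + buchsteiner_loop
begin

text \<open>
  Both sides of the Buchsteiner law are \<open>yz\<close> modulo the centre: the left side is \<open>a(x,y,z) \<cdot> yz\<close>, and
  the right side is \<open>yz\<close> multiplied by the inverse of \<open>a(y,z,x)\<close>.
\<close>

lemma associator_cycle_inverse:
  assumes x: "x \<in> carrier Q" and y: "y \<in> carrier Q" and z: "z \<in> carrier Q"
  shows "associator x y z \<otimes> associator y z x = \<one>"
proof -
  let ?a = "associator x y z" and ?b = "associator y z x"
  let ?w = "ldiv Q x ((x \<otimes> y) \<otimes> z)"
  \<comment> \<open>The common value of the two sides of the Buchsteiner law, read off from the left side.\<close>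
  have "x \<otimes> ?w = x \<otimes> (?a \<otimes> (y \<otimes> z))"
    using x y z by (simp add: ldiv_props reassociate[of x] closed centre_pull_right[of ?a x])
  then have "?w = ?a \<otimes> (y \<otimes> z)"
    by (rule l_cancel[rotated 3]) (use x y z in \<open>simp_all add: ldiv_props closed\<close>)
  moreover have "?w \<otimes> x = y \<otimes> (z \<otimes> x)"
    using x y z by (simp add: buchsteiner rdiv_props closed)
  ultimately have "(?a \<otimes> ?b) \<otimes> (y \<otimes> (z \<otimes> x)) = \<one> \<otimes> (y \<otimes> (z \<otimes> x))"
    using x y z by (simp add: reassociate[of y] closed centre_pull_left l_one)
  then show ?thesis
    by (rule r_cancel[rotated 3]) (use x y z in \<open>simp_all add: closed one_closed\<close>)
qed

lemma associator_cycle: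
  assumes x: "x \<in> carrier Q" and y: "y \<in> carrier Q" and z: "z \<in> carrier Q"
  shows "associator x y z = associator y z x"
proof -
  let ?a = "associator x y z" and ?b = "associator y z x" and ?c = "associator z x y"
  \<comment> \<open>Both neighbours of \<open>?c\<close> in the cycle are its inverse.\<close>
  have "?c \<otimes> ?b = ?b \<otimes> ?c"
    using x y z by (intro centre_commute) (simp_all add: closed)
  then have "?c \<otimes> ?a = ?c \<otimes> ?b"
    using associator_cycle_inverse[OF z x y] associator_cycle_inverse[OF y z x] by simp
  then show ?thesis
    by (rule l_cancel[rotated 3]) (use x y z in \<open>simp_all add: closed\<close>)
qed

lemma associator_order_two:
  assumes "x \<in> carrier Q" "y \<in> carrier Q" "z \<in> carrier Q" "w \<in> carrier Q"
  shows "associator x y z \<otimes> (associator x y z \<otimes> w) = w"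
proof -
  have "associator x y z \<otimes> associator x y z = \<one>"
    using associator_cycle_inverse[of x y z] associator_cycle[of x y z] assms by simp
  then show ?thesis
    using assms centre_pull_left[of "associator x y z" "associator x y z" w]
    by (simp add: closed l_one)
qed

text \<open>
  In this form of the hexagon identity both sides compare \<open>xy\<cdot>z\<close> with \<open>z\<cdot>xy\<close>. On the right \<open>z\<close> is moved past
  \<open>y\<close> and then past \<open>x\<close>; the two associators \<open>a(x,y,z)\<close> and \<open>a(z,x,y)\<close> that occur on the way agree and
  cancel, so that only \<open>a(x,z,y)\<close> remains.
\<close>

lemma commutator_mult_left:
  assumes x: "x \<in> carrier Q" and y: "y \<in> carrier Q" and z: "z \<in> carrier Q"
  shows "commutator (x \<otimes> y) z = associator x z y \<otimes> (commutator x z \<otimes> commutator y z)"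
proof -
  let ?a = "associator x y z" and ?b = "associator x z y"
    and ?c = "commutator x z" and ?d = "commutator y z"
  have cyc: "associator z x y = ?a"
    using x y z by (simp add: associator_cycle)
  have "?b \<otimes> (x \<otimes> (z \<otimes> y)) = (x \<otimes> z) \<otimes> y"
    using x y z by (simp add: reassociate)
  also have "\<dots> = ?c \<otimes> ((z \<otimes> x) \<otimes> y)"
    using x y z by (simp add: swap[of x z] closed centre_pull)
  also have "\<dots> = ?c \<otimes> (?a \<otimes> (z \<otimes> (x \<otimes> y)))"
    using x y z by (simp add: reassociate cyc)
  finally have "?b \<otimes> (?b \<otimes> (x \<otimes> (z \<otimes> y))) = ?b \<otimes> (?c \<otimes> (?a \<otimes> (z \<otimes> (x \<otimes> y))))"
    by simp
  then have past_x: "x \<otimes> (z \<otimes> y) = ?b \<otimes> (?c \<otimes> (?a \<otimes> (z \<otimes> (x \<otimes> y))))"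
    using x y z by (simp add: associator_order_two closed)
  have "commutator (x \<otimes> y) z \<otimes> (z \<otimes> (x \<otimes> y)) = (x \<otimes> y) \<otimes> z"
    using swap[of "x \<otimes> y" z] x y z by (simp add: closed)
  also have "\<dots> = ?a \<otimes> (x \<otimes> (y \<otimes> z))"
    using x y z by (simp add: reassociate)
  also have "\<dots> = ?a \<otimes> (?d \<otimes> (x \<otimes> (z \<otimes> y)))"
    using x y z by (simp add: swap[of y z] closed centre_pull_right[of ?d x])
  also have "\<dots> = ?a \<otimes> (?a \<otimes> (?b \<otimes> (?c \<otimes> (?d \<otimes> (z \<otimes> (x \<otimes> y))))))"
    unfolding past_x using x y z by (simp add: closed centre_left_commute)
  also have "\<dots> = (?b \<otimes> (?c \<otimes> ?d)) \<otimes> (z \<otimes> (x \<otimes> y))"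
    using x y z by (simp add: associator_order_two closed centre_pull_left)
  finally show ?thesis
    by (rule r_cancel[rotated 3]) (use x y z in \<open>simp_all add: closed\<close>)
qed

text \<open>
  The commutator of \<open>xy\<close> with \<open>z\<close> does not change when \<open>x\<close> and \<open>y\<close> are exchanged, so neither does the
  associator by which it deviates from being multiplicative.
\<close>

lemma associator_reverse:
  assumes x: "x \<in> carrier Q" and y: "y \<in> carrier Q" and z: "z \<in> carrier Q"
  shows "associator x z y = associator y z x"
proof -
  let ?c = "commutator x z \<otimes> commutator y z"
  have "associator x z y \<otimes> ?c = commutator (x \<otimes> y) z"
    using x y z by (simp add: commutator_mult_left)
  also have "\<dots> = commutator (y \<otimes> x) z"
    using x y z by (simp add: swap[of x y] commutator_centre_mult closed)
  also have "\<dots> = associator y z x \<otimes> ?c"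
    using x y z by (simp add: commutator_mult_left closed centre_commute[of "commutator x z"])
  finally show ?thesis
    by (rule r_cancel[rotated 3]) (use x y z in \<open>simp_all add: closed\<close>)
qed

lemma class_two_conjugacy_closed: "conjugacy_closed Q"
proof (rule conjugacy_closedI)
  fix x y z assume xyz: "x \<in> carrier Q" "y \<in> carrier Q" "z \<in> carrier Q"
  show "associator x y z = associator y x z"
    using xyz associator_reverse[of x z y] associator_cycle[of y x z]
      associator_cycle[of x z y] associator_cycle[of z y x] by metis
  show "associator x y z = associator x z y"
    using xyz associator_reverse[of x z y] associator_cycle[of x z y] by metis
qed

end

theorem corollary4p4:
  fixes Q :: "('a, 'b) monoid_scheme"
  assumes "buchsteiner_loop Q"
    and "has_nilpotency_class Q 2"
  shows "conjugacy_closed Q"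
proof -
  interpret buchsteiner_loop Q by fact
  interpret class_two_loop Q using assms(2) by (rule class_two_loopI)
  interpret class_two_buchsteiner_loop Q ..
  show ?thesis by (rule class_two_conjugacy_closed)
qed

end
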